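(* Let $k\ge 3$ and $e\ge 3$. If there exists a $(k-1)$-chromatic $e$-star system of order $n_{k-1}$ with $n_{k-1}\equiv 0\pmod{2e}$, then there exists a $k$-chromatic $e$-star system of some order $n_k$ with $n_k\equiv 0\pmod{2e}$.
   Context: An $e$-star is the complete bipartite graph $K_{1,e}$. An $e$-star system of order $n$ is a pair $(V,\mathcal B)$ where $|V|=n$ and $\mathcal B$ is a set of $e$-stars (subgraphs of the complete graph $K_n$ on $V$) whose edge sets partition the edge set of $K_n$. An $e$-star system is $k$-colourable if $V$ can be partitioned into $k$ sets (colour classes) such that no star in $\mathcal B$ has all its vertices in the same class; it is $k$-chromatic if it is $k$-colourable but not $(k-1)$-colourable. *)

theory Defs
  imports "HOL-Library.Disjoint_Sets" "HOL-Number_Theory.Cong"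
begin

text \<open>Simple graphs are pairs of a vertex set and a set of two-element edges.\<close>

type_synonym 'a graph = "'a set \<times> 'a set set"

abbreviation vertices :: "'a graph \<Rightarrow> 'a set" where
  "vertices G \<equiv> fst G"

abbreviation edges :: "'a graph \<Rightarrow> 'a set set" where
  "edges G \<equiv> snd G"

definition complete_graph :: "'a set \<Rightarrow> 'a graph" where
  "complete_graph V = (V, {{u, v} | u v. u \<in> V \<and> v \<in> V \<and> u \<noteq> v})"

definition complete_bipartite :: "'a set \<Rightarrow> 'a set \<Rightarrow> 'a graph" where
  "complete_bipartite X Y = (X \<union> Y, {{x, y} | x y. x \<in> X \<and> y \<in> Y})"

definition subgraph :: "'a graph \<Rightarrow> 'a graph \<Rightarrow> bool" where
  "subgraph H G \<longleftrightarrow> vertices H \<subseteq> vertices G \<and> edges H \<subseteq> edges G"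

definition is_star :: "nat \<Rightarrow> 'a graph \<Rightarrow> bool" where
  "is_star e S \<longleftrightarrow>
     (\<exists>c L. finite L \<and> card L = e \<and> c \<notin> L \<and> S = complete_bipartite {c} L)"

text \<open>The edge partition is stated for the family of stars indexed by themselves, so distinct
  members of \<open>\<B>\<close> have disjoint edge sets; nonemptiness of the parts is automatic for \<open>e \<ge> 1\<close>.\<close>

definition star_system :: "nat \<Rightarrow> nat \<Rightarrow> 'a set \<Rightarrow> 'a graph set \<Rightarrow> bool" where
  "star_system e n V \<B> \<longleftrightarrow>
     finite V \<and> card V = n \<and>
     (\<forall>S\<in>\<B>. is_star e S \<and> subgraph S (complete_graph V)) \<and>
     disjoint_family_on edges \<B> \<and>
     (\<Union>S\<in>\<B>. edges S) = edges (complete_graph V)"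

text \<open>Colour classes may be empty, as usual for colourings. For \<open>k \<ge> 2\<close> this does not affect which
  systems are \<open>k\<close>-chromatic: an empty class among \<open>k\<close> could be dropped, and classes can be split
  as long as there are enough vertices.\<close>

definition colourable :: "nat \<Rightarrow> 'a set \<Rightarrow> 'a graph set \<Rightarrow> bool" where
  "colourable k V \<B> \<longleftrightarrow>
     (\<exists>C :: nat \<Rightarrow> 'a set.
        disjoint_family_on C {..<k} \<and> (\<Union>i<k. C i) = V \<and>
        \<not> (\<exists>S\<in>\<B>. \<exists>i<k. vertices S \<subseteq> C i))"

definition chromatic :: "nat \<Rightarrow> 'a set \<Rightarrow> 'a graph set \<Rightarrow> bool" where
  "chromatic k V \<B> \<longleftrightarrow> colourable k V \<B> \<and> \<not> colourable (k - 1) V \<B>"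

end

theory Submission
  imports Defs "HOL-Library.FuncSet"
begin

text \<open>
  Put \<open>q = k - 1\<close>. Since the given system is not \<open>(q - 1)\<close>-colourable, each of its \<open>q\<close>-colourings
  uses all \<open>q\<close> colours. Take many disjoint copies of it, a vertex of one copy being joined to a later
  copy by stars whose leaf sets are not monochromatic under a suitable \<open>(q + 1)\<close>-colouring. In any
  \<open>q\<close>-colouring of this union, some \<open>e\<close> copies, say those indexed by \<open>J\<close>, are coloured identically.
  A further vertex that is the centre of stars with leaf sets \<open>{v} \<times> J\<close> for all \<open>v\<close> then cannot
  receive any of the \<open>q\<close> colours. Such a vertex is supplied for one \<open>J\<close> after the other, each time
  within a batch of \<open>2 * e\<close> new vertices, all of whose stars contain both old and new vertices. A
  batch therefore raises the chromatic number by at most one, and the first system of the sequence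
  that is not \<open>q\<close>-colourable is \<open>(q + 1)\<close>-chromatic.
\<close>

section \<open>Star systems as tournaments with partitioned out-neighbourhoods\<close>

text \<open>A star system viewed as a tournament: \<open>P v\<close> is the set of leaf sets of the stars with centre
  \<open>v\<close>, so it partitions the out-neighbourhood of \<open>v\<close>.\<close>

definition oriented_stars :: "nat \<Rightarrow> 'a set \<Rightarrow> ('a \<Rightarrow> 'a set set) \<Rightarrow> bool" where
  "oriented_stars e V P \<longleftrightarrow> finite V \<and>
     (\<forall>v\<in>V. disjoint (P v) \<and> v \<notin> \<Union>(P v) \<and> (\<forall>L\<in>P v. L \<subseteq> V \<and> card L = e)) \<and>
     (\<forall>u\<in>V. \<forall>v\<in>V. u \<noteq> v \<longrightarrow> (v \<in> \<Union>(P u)) \<noteq> (u \<in> \<Union>(P v)))"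

text \<open>A star is monochromatic iff all its leaves share the colour of its centre, so each leaf
  set only has to be compared with \<open>c v\<close>.\<close>

definition proper :: "nat \<Rightarrow> 'a set \<Rightarrow> ('a \<Rightarrow> 'a set set) \<Rightarrow> ('a \<Rightarrow> nat) \<Rightarrow> bool" where
  "proper q V P c \<longleftrightarrow> (\<forall>v\<in>V. c v < q) \<and> (\<forall>v\<in>V. \<forall>L\<in>P v. \<exists>x\<in>L. c x \<noteq> c v)"

lemma proper_cong:
  assumes "oriented_stars e V P" and "\<And>v. v \<in> V \<Longrightarrow> c v = d v"
  shows "proper q V P c \<longleftrightarrow> proper q V P d"
proof -
  have "c x = d x" if "v \<in> V" "L \<in> P v" "x \<in> L" for v L x
  proof -
    have "L \<subseteq> V" using assms(1) that(1,2) by (simp add: oriented_stars_def)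
    then show ?thesis using assms(2) that(3) by blast
  qed
  then show ?thesis using assms(2) by (simp add: proper_def)
qed

definition stars_of :: "'a set \<Rightarrow> ('a \<Rightarrow> 'a set set) \<Rightarrow> 'a graph set" where
  "stars_of V P = {complete_bipartite {v} L | v L. v \<in> V \<and> L \<in> P v}"

lemma vertices_star: "vertices (complete_bipartite {v} L) = insert v L"
  by (simp add: complete_bipartite_def)

lemma edges_star: "edges (complete_bipartite {v} L) = (\<lambda>y. {v, y}) ` L"
  by (auto simp: complete_bipartite_def)

text \<open>A single edge could be centred at either end. With two leaves, if
  \<open>c \<noteq> c'\<close> then some leaf \<open>y\<close> differs from \<open>c'\<close>, and
  the edge \<open>{c, y}\<close> avoids \<open>c'\<close>, so it cannot belong to the second
  star.\<close>

lemma star_inject: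
  assumes "complete_bipartite {c} L = complete_bipartite {c'} L'"
    and "c \<notin> L" "c' \<notin> L'" "card L \<ge> 2"
  shows "c = c' \<and> L = L'"
proof -
  have v: "insert c L = insert c' L'" and ed: "(\<lambda>y. {c, y}) ` L = (\<lambda>y. {c', y}) ` L'"
    using assms(1) by (metis vertices_star, metis edges_star)
  have "c = c'"
  proof (rule ccontr)
    assume "c \<noteq> c'"
    have "L - {c'} \<noteq> {}"
    proof
      assume "L - {c'} = {}"
      then have "L \<subseteq> {c'}" by blast
      then have "card L \<le> card {c'}" by (intro card_mono) auto
      then show False using assms(4) by simp
    qed
    then obtain y where y: "y \<in> L" "y \<noteq> c'" by blast
    then have "{c, y} \<in> (\<lambda>y. {c', y}) ` L'" using ed by blast
    then show False using y \<open>c \<noteq> c'\<close> by auto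
  qed
  then show ?thesis using v assms(2,3) by (simp add: insert_ident)
qed

text \<open>Two stars can share an edge in two ways: with a common centre, excluded by disjointness
  of the leaf sets, or with the ends of the edge as the two centres, excluded by the tournament
  condition. That condition also makes the stars cover every edge.\<close>

lemma star_system_stars_of:
  assumes P: "oriented_stars e V P" and e: "e \<ge> 2"
  shows "star_system e (card V) V (stars_of V P)"
proof -
  have fin: "finite V" using P by (simp add: oriented_stars_def)
  have star: "is_star e S \<and> subgraph S (complete_graph V)" if S: "S \<in> stars_of V P" for S
  proof -
    obtain v L where vL: "v \<in> V" "L \<in> P v" "S = complete_bipartite {v} L"
      using S by (auto simp: stars_of_def)
    have L: "L \<subseteq> V" "card L = e" "v \<notin> L" using P vL by (auto simp: oriented_stars_def)
    have "finite L" using L fin finite_subset by blast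
    then have "is_star e S" using L vL(3) unfolding is_star_def by blast
    moreover have "subgraph S (complete_graph V)"
      using vL L unfolding subgraph_def vL(3) vertices_star edges_star
      by (force simp: complete_graph_def)
    ultimately show ?thesis ..
  qed
  have disj: "disjoint_family_on edges (stars_of V P)"
    unfolding disjoint_family_on_def
  proof (intro ballI impI)
    fix S T assume ST: "S \<in> stars_of V P" "T \<in> stars_of V P" "S \<noteq> T"
    obtain v L where vL: "v \<in> V" "L \<in> P v" "S = complete_bipartite {v} L"
      using ST by (auto simp: stars_of_def)
    obtain u M where uM: "u \<in> V" "M \<in> P u" "T = complete_bipartite {u} M"
      using ST by (auto simp: stars_of_def)
    have sub: "L \<subseteq> V" "M \<subseteq> V" using P vL uM by (auto simp: oriented_stars_def)
    show "edges S \<inter> edges T = {}"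
    proof (rule ccontr)
      assume "edges S \<inter> edges T \<noteq> {}"
      then obtain x y where xy: "x \<in> L" "y \<in> M" "{v, x} = {u, y}"
        unfolding vL(3) uM(3) edges_star by blast
      then consider "v = u" "x = y" | "v = y" "x = u" by (auto simp: doubleton_eq_iff)
      then show False
      proof cases
        case 1
        have "disjoint (P v)" using P vL by (auto simp: oriented_stars_def)
        then have "L = M" using 1 xy vL uM unfolding disjoint_def by blast
        then show False using 1 vL uM ST by simp
      next
        case 2
        have "u \<noteq> v" using P vL xy 2 by (auto simp: oriented_stars_def)
        moreover have "v \<in> \<Union>(P u)" "u \<in> \<Union>(P v)" using xy 2 vL uM by auto
        ultimately show False using P vL(1) uM(1) unfolding oriented_stars_def by blast
      qed
    qed
  qed
  have un: "(\<Union>S\<in>stars_of V P. edges S) = edges (complete_graph V)"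
  proof
    show "(\<Union>S\<in>stars_of V P. edges S) \<subseteq> edges (complete_graph V)"
      using star by (auto simp: subgraph_def)
    show "edges (complete_graph V) \<subseteq> (\<Union>S\<in>stars_of V P. edges S)"
    proof
      fix a assume "a \<in> edges (complete_graph V)"
      then obtain u v where uv: "a = {u, v}" "u \<in> V" "v \<in> V" "u \<noteq> v"
        by (auto simp: complete_graph_def)
      have key: "{x, y} \<in> (\<Union>S\<in>stars_of V P. edges S)" if "x \<in> V" "y \<in> \<Union>(P x)" for x y
      proof -
        obtain L where L: "L \<in> P x" "y \<in> L" using \<open>y \<in> \<Union>(P x)\<close> by blast
        then have "complete_bipartite {x} L \<in> stars_of V P" using that by (auto simp: stars_of_def)
        moreover have "{x, y} \<in> edges (complete_bipartite {x} L)" using L by (simp add: edges_star)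
        ultimately show ?thesis by blast
      qed
      have "v \<in> \<Union>(P u) \<or> u \<in> \<Union>(P v)"
        using P uv unfolding oriented_stars_def by blast
      then show "a \<in> (\<Union>S\<in>stars_of V P. edges S)"
        using key[of u v] key[of v u] uv by (auto simp: insert_commute)
    qed
  qed
  show ?thesis using fin star disj un by (simp add: star_system_def)
qed

text \<open>Each edge is directed from the centre of its star to the leaf. This is well defined
  because the edge lies in one star only and, by \<open>star_inject\<close>, a star determines its
  centre.\<close>

lemma oriented_stars_if_star_system:
  fixes V :: "'a set"
  assumes B: "star_system e n V \<B>" and e: "e \<ge> 2"
  obtains P where "oriented_stars e V P" "\<B> = stars_of V P"
proof
  define P where "P v = {L. v \<notin> L \<and> card L = e \<and> complete_bipartite {v} L \<in> \<B>}" for v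
  have sg: "is_star e S" "subgraph S (complete_graph V)" if "S \<in> \<B>" for S
    using B that by (auto simp: star_system_def)
  have inV: "v \<in> V \<and> L \<subseteq> V" if "L \<in> P v" for v L
    using sg(2)[of "complete_bipartite {v} L"] that
    by (auto simp: P_def subgraph_def vertices_star complete_graph_def)
  have disj: "S = T" if "S \<in> \<B>" "T \<in> \<B>" "a \<in> edges S" "a \<in> edges T" for S T a
    using B that unfolding star_system_def disjoint_family_on_def by blast
  have inj: "v = u \<and> L = M" if "L \<in> P v" "M \<in> P u" "x \<in> L" "y \<in> M" "{v, x} = {u, y}"
    for v u x y L M
  proof -
    have "complete_bipartite {v} L = complete_bipartite {u} M"
      using that by (intro disj[of _ _ "{v, x}"]) (auto simp: P_def edges_star)
    then show ?thesis using that e by (intro star_inject) (auto simp: P_def)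
  qed
  have cov: "v \<in> \<Union>(P u) \<or> u \<in> \<Union>(P v)" if uv: "u \<in> V" "v \<in> V" "u \<noteq> v" for u v
  proof -
    have "{u, v} \<in> edges (complete_graph V)" using uv by (auto simp: complete_graph_def)
    then obtain S where S: "S \<in> \<B>" "{u, v} \<in> edges S" using B unfolding star_system_def by blast
    obtain c L where cL: "card L = e" "c \<notin> L" "S = complete_bipartite {c} L"
      using sg(1)[OF S(1)] by (auto simp: is_star_def)
    then have "L \<in> P c" using S by (simp add: P_def)
    moreover have "(u = c \<and> v \<in> L) \<or> (v = c \<and> u \<in> L)"
      using S(2) unfolding cL(3) edges_star by (auto simp: doubleton_eq_iff)
    ultimately show ?thesis by blast
  qed
  show "oriented_stars e V P"
    unfolding oriented_stars_def
  proof (intro conjI ballI impI)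
    show "finite V" using B by (simp add: star_system_def)
    show "disjoint (P v)" for v
      unfolding disjoint_def using inj by blast
    show "v \<notin> \<Union>(P v)" for v by (auto simp: P_def)
    show "L \<subseteq> V" "card L = e" if "L \<in> P v" for v L
      using that inV by (auto simp: P_def)
    show "(v \<in> \<Union>(P u)) \<noteq> (u \<in> \<Union>(P v))" if "u \<in> V" "v \<in> V" "u \<noteq> v" for u v
      \<comment> \<open>If both directions occurred, \<open>inj\<close> applied to
        \<open>{u, v} = {v, u}\<close> would identify the two centres.\<close>
      using cov[OF that] inj[of _ u _ v v u] that(3) by (auto simp: insert_commute)
  qed
  show "\<B> = stars_of V P"
  proof
    show "stars_of V P \<subseteq> \<B>" by (auto simp: stars_of_def P_def)
    show "\<B> \<subseteq> stars_of V P"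
    proof
      fix S assume S: "S \<in> \<B>"
      obtain c L where cL: "card L = e" "c \<notin> L" "S = complete_bipartite {c} L"
        using sg(1)[OF S] by (auto simp: is_star_def)
      then have "L \<in> P c" using S by (simp add: P_def)
      then show "S \<in> stars_of V P" using inV[of L c] cL(3) by (auto simp: stars_of_def)
    qed
  qed
qed

lemma colourable_stars_of_iff:
  assumes P: "oriented_stars e V P"
  shows "colourable q V (stars_of V P) \<longleftrightarrow> (\<exists>c. proper q V P c)"
proof
  assume "colourable q V (stars_of V P)"
  then obtain C :: "nat \<Rightarrow> 'a set" where C: "disjoint_family_on C {..<q}" "(\<Union>i<q. C i) = V"
    and nm: "\<not> (\<exists>S\<in>stars_of V P. \<exists>i<q. vertices S \<subseteq> C i)"
    unfolding colourable_def by blast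
  have "\<forall>v\<in>V. \<exists>i<q. v \<in> C i" using C(2) by blast
  then obtain c where c: "\<And>v. v \<in> V \<Longrightarrow> c v < q \<and> v \<in> C (c v)" by metis
  have "\<exists>x\<in>L. c x \<noteq> c v" if vL: "v \<in> V" "L \<in> P v" for v L
  proof (rule ccontr)
    assume "\<not> ?thesis"
    moreover have "L \<subseteq> V" using P vL by (auto simp: oriented_stars_def)
    ultimately have "insert v L \<subseteq> C (c v)" using c vL by (metis insert_subset subset_iff)
    moreover have "complete_bipartite {v} L \<in> stars_of V P" using vL by (auto simp: stars_of_def)
    ultimately show False using nm c[OF vL(1)] vertices_star by metis
  qed
  then show "\<exists>c. proper q V P c" using c by (auto simp: proper_def)
next
  assume "\<exists>c. proper q V P c"
  then obtain c where c: "proper q V P c" ..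
  show "colourable q V (stars_of V P)"
    unfolding colourable_def
  proof (intro exI conjI)
    show "disjoint_family_on (\<lambda>i. {v\<in>V. c v = i}) {..<q}" by (auto simp: disjoint_family_on_def)
    show "(\<Union>i<q. {v \<in> V. c v = i}) = V" using c by (auto simp: proper_def)
    show "\<not> (\<exists>S\<in>stars_of V P. \<exists>i<q. vertices S \<subseteq> {v \<in> V. c v = i})"
    proof
      assume "\<exists>S\<in>stars_of V P. \<exists>i<q. vertices S \<subseteq> {v \<in> V. c v = i}"
      then obtain v L i where vL: "v \<in> V" "L \<in> P v" and i: "insert v L \<subseteq> {v \<in> V. c v = i}"
        by (force simp: stars_of_def complete_bipartite_def)
      obtain x where "x \<in> L" "c x \<noteq> c v" using c vL unfolding proper_def by blast
      then show False using i by auto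
    qed
  qed
qed

text \<open>Relabelling: it moves a system onto an initial segment of the naturals, where further
  vertices can simply be appended.\<close>

lemma oriented_stars_image:
  assumes P: "oriented_stars e V P" and f: "inj_on f V"
    and P': "\<And>v. v \<in> V \<Longrightarrow> P' (f v) = (`) f ` P v"
  shows "oriented_stars e (f ` V) P'"
    and "proper q (f ` V) P' c \<longleftrightarrow> proper q V P (c \<circ> f)"
proof -
  have sub: "L \<subseteq> V" if "v \<in> V" "L \<in> P v" for v L using P that by (auto simp: oriented_stars_def)
  have mem: "f u \<in> \<Union>(P' (f v)) \<longleftrightarrow> u \<in> \<Union>(P v)" if uv: "u \<in> V" "v \<in> V" for u v
  proof -
    have "f u \<in> f ` L \<longleftrightarrow> u \<in> L" if "L \<in> P v" for L
      using inj_on_image_mem_iff[OF f uv(1) sub[OF uv(2) that]] .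
    then show ?thesis using P'[OF uv(2)] by auto
  qed
  have dj: "disjoint (P' (f v))" if v: "v \<in> V" for v
  proof -
    have "disjoint (P v)" using P v by (auto simp: oriented_stars_def)
    moreover have "inj_on f (\<Union>(P v))"
      using f sub[OF v] by (meson Sup_le_iff inj_on_subset)
    ultimately show ?thesis unfolding P'[OF v] by (simp add: disjoint_image)
  qed
  have lf: "M \<subseteq> f ` V \<and> card M = e" if v: "v \<in> V" "M \<in> P' (f v)" for v M
  proof -
    obtain L where L: "L \<in> P v" "M = f ` L" using v P' by auto
    moreover have "card (f ` L) = card L"
      using sub[OF v(1) L(1)] f by (meson card_image inj_on_subset)
    moreover have "card L = e" using P v(1) L(1) by (simp add: oriented_stars_def)
    ultimately show ?thesis using sub[OF v(1) L(1)] by auto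
  qed
  have nl: "f v \<notin> \<Union>(P' (f v))" if "v \<in> V" for v
    using mem[OF that that] P that by (auto simp: oriented_stars_def)
  have tour: "(f v \<in> \<Union>(P' (f u))) \<noteq> (f u \<in> \<Union>(P' (f v)))" if "u \<in> V" "v \<in> V" "u \<noteq> v" for u v
    using mem[OF that(1,2)] mem[OF that(2,1)] P that by (simp add: oriented_stars_def)
  show "oriented_stars e (f ` V) P'"
    unfolding oriented_stars_def ball_simps(9)
  proof (intro conjI ballI impI)
    show "finite (f ` V)" using P by (simp add: oriented_stars_def)
    show "(f v \<in> \<Union>(P' (f u))) \<noteq> (f u \<in> \<Union>(P' (f v)))" if "u \<in> V" "v \<in> V" "f u \<noteq> f v" for u v
      using tour that by metis
  qed (use dj nl lf in auto)
  show "proper q (f ` V) P' c \<longleftrightarrow> proper q V P (c \<circ> f)"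
    by (auto simp: proper_def P')
qed

section \<open>Partitions into sets of equal size, and balanced colourings\<close>

text \<open>The prescribed parts cover a multiple of \<open>e\<close> elements, so the number left
  over is again a multiple of \<open>e\<close>, and the rest can be cut up arbitrarily.\<close>

lemma extend_to_uniform_partition:
  assumes "finite A" "e > 0" "e dvd card A"
    and "disjoint G" "\<And>g. g \<in> G \<Longrightarrow> g \<subseteq> A \<and> card g = e"
  obtains Q where "G \<subseteq> Q" "disjoint Q" "\<Union>Q = A" "\<And>g. g \<in> Q \<Longrightarrow> card g = e"
proof -
  have free: "\<exists>Q. disjoint Q \<and> \<Union>Q = D \<and> (\<forall>g\<in>Q. card g = e)"
    if "finite D" "card D = e * m" for D :: "'a set" and m
    using that
  proof (induction m arbitrary: D)
    case 0
    then show ?case by (intro exI[of _ "{}"]) (auto simp: disjoint_def)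
  next
    case (Suc m)
    then obtain g where g: "g \<subseteq> D" "card g = e" by (metis le_add1 mult_Suc_right obtain_subset_with_card_n)
    then have "card (D - g) = e * m"
      using Suc.prems card_Diff_subset[of g D] finite_subset[of g D] by simp
    then obtain Q where Q: "disjoint Q" "\<Union>Q = D - g" "\<forall>h\<in>Q. card h = e"
      using Suc.IH[of "D - g"] Suc.prems by auto
    have "disjoint (insert g Q)" using Q(1,2) by (auto simp: disjoint_def)
    then show ?case using Q g by (intro exI[of _ "insert g Q"]) auto
  qed
  have sub: "\<Union>G \<subseteq> A" using assms(5) by blast
  then have fG: "finite (\<Union>G)" using assms(1) finite_subset by blast
  have "card (\<Union>G) = (\<Sum>g\<in>G. card g)"
    using assms(1,4,5) finite_subset[OF _ assms(1)]
    by (intro card_Union_disjoint) (auto simp: disjoint_def pairwise_def disjnt_def)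
  also have "\<dots> = e * card G" using assms(5) by simp
  finally have "e dvd card (A - \<Union>G)"
    using assms(3) card_Diff_subset[OF fG sub] by simp
  then obtain m where "card (A - \<Union>G) = e * m" ..
  from free[OF _ this] obtain Q where Q: "disjoint Q" "\<Union>Q = A - \<Union>G" "\<forall>g\<in>Q. card g = e"
    using assms(1) by auto
  show ?thesis
  proof (rule that[of "G \<union> Q"])
    show "disjoint (G \<union> Q)" using assms(4) Q(1,2) by (intro disjoint_union) auto
    show "\<Union>(G \<union> Q) = A" using Q(2) sub by auto
    show "card g = e" if "g \<in> G \<union> Q" for g using that Q(3) assms(5) by blast
  qed simp
qed

lemma bichromatic_uniform_partition:
  fixes c :: "'a \<Rightarrow> nat"
  assumes V: "finite V" and e: "e \<ge> 2" "e dvd card V"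
    and bal: "\<And>i. 2 * card {v\<in>V. c v = i} \<le> card V"
  obtains Q where "disjoint Q" "\<Union>Q = V" "\<And>g. g \<in> Q \<Longrightarrow> card g = e"
    "\<And>g. g \<in> Q \<Longrightarrow> \<exists>x\<in>g. \<exists>y\<in>g. c x \<noteq> c y"
proof -
  \<comment> \<open>List \<open>V\<close> by colour and cut it along residue classes modulo \<open>card V / e\<close>: the first and the
    last element of a part are too far apart to have the same colour.\<close>
  obtain xs0 where xs0: "set xs0 = V" "distinct xs0" using finite_distinct_list[OF V] by blast
  define xs where "xs = sort_key c xs0"
  have xs: "set xs = V" "distinct xs" "sorted (map c xs)" using xs0 by (simp_all add: xs_def)
  have len: "length xs = card V" using xs distinct_card by fastforce
  obtain s where s: "card V = e * s" using e(2) ..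
  define K where "K i = (\<lambda>t. t * s + i) ` {..<e}" for i
  have Ksub: "K i \<subseteq> {..<card V}" if "i < s" for i
  proof
    fix k assume "k \<in> K i"
    then obtain t where t: "t < e" "k = t * s + i" by (auto simp: K_def)
    have "Suc t * s \<le> e * s" using t by (intro mult_le_mono1) simp
    then show "k \<in> {..<card V}" using t that s by simp
  qed
  have Kmod: "k mod s = i" if "i < s" "k \<in> K i" for i k
    using that by (auto simp: K_def)
  have nth_inj: "inj_on ((!) xs) {..<card V}"
    using xs(2) len by (simp add: inj_on_nth)
  define Q where "Q = (\<lambda>i. (!) xs ` K i) ` {..<s}"
  show ?thesis
  proof (rule that[of Q])
    show "disjoint Q"
      unfolding disjoint_def
    proof (intro ballI impI)
      fix g h assume "g \<in> Q" "h \<in> Q" "g \<noteq> h"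
      then obtain i j where ij: "i < s" "j < s" "g = (!) xs ` K i" "h = (!) xs ` K j" "i \<noteq> j"
        by (auto simp: Q_def)
      then have "K i \<inter> K j = {}" using Kmod by blast
      then show "g \<inter> h = {}"
        using inj_on_image_Int[OF nth_inj Ksub[OF ij(1)] Ksub[OF ij(2)]] ij by simp
    qed
    show "\<Union>Q = V"
    proof
      show "\<Union>Q \<subseteq> V" using Ksub len xs(1) by (fastforce simp: Q_def)
      show "V \<subseteq> \<Union>Q"
      proof
        fix x assume "x \<in> V"
        then obtain k where k: "k < card V" "x = xs ! k" using xs(1) len by (metis in_set_conv_nth)
        then have "s > 0" using s by (cases s) auto
        have "k div s < e" using k(1) s by (simp add: less_mult_imp_div_less)
        then have "k \<in> K (k mod s)" unfolding K_def
          by (intro image_eqI[of _ _ "k div s"]) auto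
        then show "x \<in> \<Union>Q" using \<open>s > 0\<close> k(2) by (auto simp: Q_def)
      qed
    qed
    show "card g = e" if gQ: "g \<in> Q" for g
    proof -
      obtain i where i: "i < s" "g = (!) xs ` K i" using gQ by (auto simp: Q_def)
      have "card g = card (K i)"
        unfolding i(2) using inj_on_subset[OF nth_inj Ksub[OF i(1)]] by (rule card_image)
      also have "\<dots> = card {..<e}"
        unfolding K_def using i(1) by (intro card_image) (auto simp: inj_on_def)
      finally show ?thesis by simp
    qed
    show "\<exists>x\<in>g. \<exists>y\<in>g. c x \<noteq> c y" if gQ: "g \<in> Q" for g
    proof (rule ccontr)
      assume mono: "\<not> ?thesis"
      obtain i where i: "i < s" "g = (!) xs ` K i" using gQ by (auto simp: Q_def)
      let ?l = "(e - 1) * s + i"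
      have iK: "i \<in> K i" unfolding K_def using e(1) by (intro image_eqI[of _ _ 0]) auto
      have lK: "?l \<in> K i" unfolding K_def using e(1) by (intro image_eqI[of _ _ "e - 1"]) auto
      have l: "?l < card V" using Ksub[OF i(1)] lK by blast
      have eq: "c (xs ! i) = c (xs ! ?l)" using mono iK lK i(2) by blast
      \<comment> \<open>Sortedness squeezes every colour between the equal colours at the two
        ends.\<close>
      have const: "c (xs ! k) = c (xs ! i)" if "k \<in> {i..?l}" for k
      proof (rule antisym)
        show "c (xs ! k) \<le> c (xs ! i)"
          using sorted_nth_mono[OF xs(3), of k ?l] that l len eq by auto
        show "c (xs ! i) \<le> c (xs ! k)"
          using sorted_nth_mono[OF xs(3), of i k] that l len by auto
      qed
      have "(!) xs ` {i..?l} \<subseteq> {v\<in>V. c v = c (xs ! i)}"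
      proof (intro image_subsetI CollectI conjI)
        fix k assume k: "k \<in> {i..?l}"
        then have "k < length xs" using l len by simp
        then show "xs ! k \<in> V" using xs(1) nth_mem by blast
        show "c (xs ! k) = c (xs ! i)" using const[OF k] .
      qed
      then have "card ((!) xs ` {i..?l}) \<le> card {v\<in>V. c v = c (xs ! i)}"
        using V by (intro card_mono) auto
      moreover have "card ((!) xs ` {i..?l}) = card {i..?l}"
        using l by (intro card_image inj_on_subset[OF nth_inj]) auto
      \<comment> \<open>The monochromatic stretch has \<open>(e - 1) * s + 1\<close> entries, which
        is more than half of \<open>e * s\<close> because
        \<open>e \<le> 2 * (e - 1)\<close>.\<close>
      ultimately have "2 * ((e - 1) * s + 1) \<le> e * s"
        using bal[of "c (xs ! i)"] s by simp
      moreover have "e * s \<le> 2 * ((e - 1) * s)"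
        unfolding mult.assoc[symmetric] using e(1) by (intro mult_le_mono1) simp
      ultimately have "2 * ((e - 1) * s + 1) \<le> 2 * ((e - 1) * s)" by (rule order_trans)
      then show False by simp
    qed
  qed
qed

text \<open>One spare colour buys the balance condition under which
  \<open>bichromatic_uniform_partition\<close> applies.\<close>

lemma balanced_colouring:
  assumes P: "oriented_stars e V P" and c: "proper q V P c" and ev: "even (card V)"
  obtains c' where "proper (Suc q) V P c'" "\<And>i. 2 * card {v\<in>V. c' v = i} \<le> card V"
proof (cases "\<exists>a. 2 * card {v\<in>V. c v = a} > card V")
  case False
  moreover have "proper (Suc q) V P c" using c by (auto simp: proper_def intro: less_SucI)
  ultimately show ?thesis using that[of c] by (auto simp: not_less)
next
  case True
  \<comment> \<open>Splitting the majority class into two halves leaves no class with more than half of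
    the vertices.\<close>
  then obtain a where a: "2 * card {v\<in>V. c v = a} > card V" ..
  define A where "A = {v\<in>V. c v = a}"
  have V: "finite V" using P by (simp add: oriented_stars_def)
  then have A: "finite A" "A \<subseteq> V" "card A \<le> card V" by (auto simp: A_def intro: card_mono)
  obtain B where B: "B \<subseteq> A" "card B = card A div 2"
    by (metis div_le_dividend obtain_subset_with_card_n)
  define c' where "c' v = (if v \<in> B then q else c v)" for v
  have lt: "c v < q" if "v \<in> V" for v using c that by (simp add: proper_def)
  \<comment> \<open>The recolouring only refines the classes: the new colour \<open>q\<close> is
    fresh and is given to vertices of a single old class.\<close>
  have ne: "c' x \<noteq> c' v" if "x \<in> V" "v \<in> V" "c x \<noteq> c v" for x v
    using that lt[of x] lt[of v] B(1) by (auto simp: c'_def A_def)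
  have "proper (Suc q) V P c'"
    unfolding proper_def
  proof (intro conjI ballI)
    show "c' v < Suc q" if "v \<in> V" for v using lt[OF that] by (simp add: c'_def)
    show "\<exists>x\<in>L. c' x \<noteq> c' v" if vL: "v \<in> V" "L \<in> P v" for v L
    proof -
      obtain x where "x \<in> L" "c x \<noteq> c v" using c vL unfolding proper_def by blast
      moreover have "L \<subseteq> V" using P vL by (simp add: oriented_stars_def)
      ultimately show ?thesis using ne vL(1) by blast
    qed
  qed
  moreover have "2 * card {v\<in>V. c' v = i} \<le> card V" for i
  proof -
    consider "i = q" | "i = a" "i \<noteq> q" | "i \<noteq> a" "i \<noteq> q" by blast
    then show ?thesis
    proof cases
      case 1
      then have "{v\<in>V. c' v = i} \<subseteq> B" using lt by (auto simp: c'_def)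
      then have "card {v\<in>V. c' v = i} \<le> card B"
        using B(1) A(1) by (meson card_mono finite_subset)
      then show ?thesis using B(2) A(3) by simp
    next
      case 2
      then have "{v\<in>V. c' v = i} = A - B" by (auto simp: c'_def A_def)
      moreover have "card (A - B) = card A - card A div 2"
        using B A(1) by (simp add: card_Diff_subset finite_subset)
      \<comment> \<open>This is the half that is rounded up. If \<open>card A\<close> is odd,
        evenness of \<open>card V\<close> gives \<open>card A < card V\<close>, which absorbs the
        rounding.\<close>
      ultimately show ?thesis using A(3) ev by presburger
    next
      case 3
      then have "{v\<in>V. c' v = i} \<subseteq> V - A" by (auto simp: c'_def A_def)
      then have "card {v\<in>V. c' v = i} \<le> card (V - A)" using V by (intro card_mono) auto
      also have "\<dots> = card V - card A" using A by (simp add: card_Diff_subset)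
      finally show ?thesis using a by (simp add: A_def)
    qed
  qed
  ultimately show ?thesis by (rule that)
qed

section \<open>Disjoint copies of a system and their colourings\<close>

text \<open>Edges between copies point to the later copy and are grouped into parts of
  \<open>Q\<close> inside that copy. A proper colouring of one copy, repeated on all of them, thus
  stays proper if no part of \<open>Q\<close> is monochromatic.\<close>

definition copies :: "nat \<Rightarrow> 'a set set \<Rightarrow> ('a \<Rightarrow> 'a set set) \<Rightarrow> 'a \<times> nat \<Rightarrow> ('a \<times> nat) set set" where
  "copies N Q P = (\<lambda>(x, j). (\<lambda>L. L \<times> {j}) ` P x \<union> (\<Union>l\<in>{j<..<N}. (\<lambda>g. g \<times> {l}) ` Q))"

lemma oriented_stars_copies:
  assumes P: "oriented_stars e V P"
    and Q: "disjoint Q" "\<Union>Q = V" "\<And>g. g \<in> Q \<Longrightarrow> card g = e"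
  shows "oriented_stars e (V \<times> {..<N}) (copies N Q P)"
proof -
  have V: "finite V" using P by (simp add: oriented_stars_def)
  have mem: "(y, l) \<in> \<Union>(copies N Q P (x, j)) \<longleftrightarrow> (l = j \<and> y \<in> \<Union>(P x)) \<or> (y \<in> V \<and> j < l \<and> l < N)"
    for x y l j
  proof -
    have "\<Union>(copies N Q P (x, j)) = \<Union>(P x) \<times> {j} \<union> \<Union>Q \<times> {j<..<N}"
      unfolding copies_def by auto
    then show ?thesis using Q(2) by auto
  qed
  show ?thesis
    unfolding oriented_stars_def
  proof (intro conjI ballI impI)
    show "finite (V \<times> {..<N})" using V by simp
  next
    fix v assume "v \<in> V \<times> {..<N}"
    then obtain x j where v: "v = (x, j)" "x \<in> V" "j < N" by auto
    have d: "disjoint (P x)" and Px: "\<And>L. L \<in> P x \<Longrightarrow> L \<subseteq> V \<and> card L = e" and nx: "x \<notin> \<Union>(P x)"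
      using P v(2) by (auto simp: oriented_stars_def)
    show "disjoint (copies N Q P v)"
      unfolding disjoint_def
    proof (intro ballI impI)
      fix M M' assume M: "M \<in> copies N Q P v" "M' \<in> copies N Q P v" "M \<noteq> M'"
      have "(\<exists>L l. M = L \<times> {l} \<and> (l = j \<and> L \<in> P x \<or> j < l \<and> L \<in> Q))"
        "(\<exists>L l. M' = L \<times> {l} \<and> (l = j \<and> L \<in> P x \<or> j < l \<and> L \<in> Q))"
        using M v(1) by (auto simp: copies_def)
      then obtain L l L' l' where L: "M = L \<times> {l}" "l = j \<and> L \<in> P x \<or> j < l \<and> L \<in> Q"
        and L': "M' = L' \<times> {l'}" "l' = j \<and> L' \<in> P x \<or> j < l' \<and> L' \<in> Q" by blast
      \<comment> \<open>Leaf sets in the same copy come from the same source: \<open>P x\<close> in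
        the centre's own copy, \<open>Q\<close> in a later one.\<close>
      have "L \<inter> L' = {}" if "l = l'"
      proof -
        have "L \<noteq> L'" using that M(3) L(1) L'(1) by blast
        then show ?thesis using that L(2) L'(2) d Q(1) by (metis disjointD less_irrefl)
      qed
      then show "M \<inter> M' = {}" using L(1) L'(1) by auto
    qed
    show "v \<notin> \<Union>(copies N Q P v)" using mem[of x j x j] nx v(1) by simp
    fix M assume M: "M \<in> copies N Q P v"
    then obtain L l where L: "M = L \<times> {l}" "l < N" "L \<in> P x \<or> L \<in> Q"
      using v by (auto simp: copies_def)
    then show "M \<subseteq> V \<times> {..<N}" using Px Q(2) by auto
    show "card M = e" using L Px Q(3) by (auto simp: card_cartesian_product)
  next
    fix u v assume uv: "u \<in> V \<times> {..<N}" "v \<in> V \<times> {..<N}" "u \<noteq> v"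
    then obtain x j y l where xy: "u = (x, j)" "v = (y, l)" "x \<in> V" "y \<in> V" "j < N" "l < N" by auto
    show "(v \<in> \<Union>(copies N Q P u)) \<noteq> (u \<in> \<Union>(copies N Q P v))"
    proof (cases "j = l")
      case True
      then have "x \<noteq> y" using uv xy by simp
      then have "(y \<in> \<Union>(P x)) \<noteq> (x \<in> \<Union>(P y))" using P xy(3,4) by (simp add: oriented_stars_def)
      then show ?thesis using True by (simp only: xy(1,2) mem) simp
    next
      case False
      then show ?thesis using xy(3-6) by (simp only: xy(1,2) mem) auto
    qed
  qed
qed

lemma proper_copies:
  assumes c: "proper q V P c" and Q: "\<And>g. g \<in> Q \<Longrightarrow> \<exists>x\<in>g. \<exists>y\<in>g. c x \<noteq> c y"
  shows "proper q (V \<times> {..<N}) (copies N Q P) (c \<circ> fst)"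
  unfolding proper_def
proof (intro conjI ballI)
  show "(c \<circ> fst) v < q" if "v \<in> V \<times> {..<N}" for v using c that by (auto simp: proper_def)
next
  fix v M assume v: "v \<in> V \<times> {..<N}" and M: "M \<in> copies N Q P v"
  obtain x j where xj: "v = (x, j)" "x \<in> V" using v by auto
  then obtain L l where L: "M = L \<times> {l}" "L \<in> P x \<or> L \<in> Q" using M by (auto simp: copies_def)
  \<comment> \<open>A part of \<open>Q\<close> shows two colours, so it has a vertex that differs
    from the centre, whatever the centre's colour.\<close>
  have "\<exists>y\<in>L. c y \<noteq> c x"
    using L(2) Q[of L] c xj(2) unfolding proper_def by metis
  then show "\<exists>y\<in>M. (c \<circ> fst) y \<noteq> (c \<circ> fst) v" using L(1) xj by auto
qed

lemma proper_copy:
  assumes "proper q (V \<times> {..<N}) (copies N Q P) d" and "j < N"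
  shows "proper q V P (\<lambda>x. d (x, j))"
  unfolding proper_def
proof (intro conjI ballI)
  show "d (v, j) < q" if "v \<in> V" for v using assms that by (auto simp: proper_def)
  show "\<exists>x\<in>L. d (x, j) \<noteq> d (v, j)" if vL: "v \<in> V" "L \<in> P v" for v L
  proof -
    have "L \<times> {j} \<in> copies N Q P (v, j)" using vL(2) by (auto simp: copies_def)
    moreover have "(v, j) \<in> V \<times> {..<N}" using vL(1) assms(2) by simp
    ultimately have "\<exists>y\<in>L \<times> {j}. d y \<noteq> d (v, j)" using assms(1) unfolding proper_def by blast
    then show ?thesis by auto
  qed
qed

text \<open>If colour \<open>i\<close> were missing, the last colour \<open>q - 1\<close> could be
  renamed to \<open>i\<close>, leaving a proper colouring with \<open>q - 1\<close> colours.\<close>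

lemma proper_uses_all_colours:
  assumes P: "oriented_stars e V P" and c: "proper q V P c"
    and min: "\<not> (\<exists>c. proper (q - 1) V P c)" and i: "i < q"
  shows "\<exists>v\<in>V. c v = i"
proof (rule ccontr)
  assume no: "\<not> ?thesis"
  define c' where "c' v = (if c v = q - 1 then i else c v)" for v
  have ne: "c' x \<noteq> c' v" if "x \<in> V" "v \<in> V" "c x \<noteq> c v" for x v
    using that no by (auto simp: c'_def)
  have "proper (q - 1) V P c'"
    unfolding proper_def
  proof (intro conjI ballI)
    show "c' v < q - 1" if "v \<in> V" for v
    proof -
      have "c v < q" "c v \<noteq> i" using c no that by (auto simp: proper_def)
      then show ?thesis using i by (auto simp: c'_def)
    qed
    show "\<exists>x\<in>L. c' x \<noteq> c' v" if vL: "v \<in> V" "L \<in> P v" for v L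
    proof -
      obtain x where "x \<in> L" "c x \<noteq> c v" using c vL unfolding proper_def by blast
      moreover have "L \<subseteq> V" using P vL by (simp add: oriented_stars_def)
      ultimately show ?thesis using ne vL(1) by blast
    qed
  qed
  then show False using min by blast
qed

section \<open>Batches of new vertices\<close>

text \<open>In the rotational tournament on the \<open>2 * e - 1\<close> vertices from
  \<open>m\<close> on, each vertex dominates the next \<open>e - 1\<close> in cyclic order. The
  alternative \<open>x + e \<le> w\<close> describes those reached after wrapping around.\<close>

lemma card_rotational_outneighbours:
  fixes m e w :: nat
  assumes "m \<le> w" "w < m + 2 * e - 1"
  shows "card {x. m \<le> x \<and> x < m + 2 * e - 1 \<and> (w < x \<and> x < w + e \<or> x + e \<le> w)} = e - 1"
    (is "card ?A = _")
\<comment> \<open>For \<open>w < m + e\<close> the next \<open>e - 1\<close> vertices are reached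
  without wrapping around.\<close>
proof (cases "w < m + e")
  case True
  then have "?A = {w<..<w + e}" using assms by auto
  then show ?thesis by simp
next
  case False
  then have "?A = {w<..<m + 2 * e - 1} \<union> {m..<w - e + 1}" using assms by auto
  moreover have "{w<..<m + 2 * e - 1} \<inter> {m..<w - e + 1} = {}" by auto
  ultimately have "card ?A = card {w<..<m + 2 * e - 1} + card {m..<w - e + 1}"
    by (simp add: card_Un_disjoint)
  then show ?thesis using False assms by simp
qed

text \<open>The new vertices carry a rotational tournament on \<open>2 * e - 1\<close> vertices together with a sink,
  so every new vertex but the sink has exactly \<open>e\<close> new out-neighbours, and they all dominate the old
  vertices. The leaf sets at the sink can be prescribed.\<close>

lemma extend_by_sink:
  assumes P: "oriented_stars e {..<m} P" and e: "e \<ge> 2" and m: "e dvd m" "m > 0"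
    and G: "disjoint G" "\<And>g. g \<in> G \<Longrightarrow> g \<subseteq> {..<m} \<and> card g = e"
  obtains P' w where "oriented_stars e {..<m + 2 * e} P'" "\<And>v. v < m \<Longrightarrow> P' v = P v"
    "w < m + 2 * e" "G \<subseteq> P' w"
    "\<And>v L. m \<le> v \<Longrightarrow> v < m + 2 * e \<Longrightarrow> L \<in> P' v \<Longrightarrow> \<exists>x\<in>L. x < m"
proof -
  \<comment> \<open>\<open>s\<close>, the last new vertex, is the sink among the new ones;
    \<open>D w\<close> is the out-neighbourhood of \<open>w\<close> within the rotational
    tournament.\<close>
  define s where "s = m + 2 * e - 1"
  define D where "D w = {x. m \<le> x \<and> x < s \<and> (w < x \<and> x < w + e \<or> x + e \<le> w)}" for w
  have em: "e \<le> m" using m dvd_imp_le by blast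
  have ms: "m < s" "m + 2 * e = Suc s" using e by (auto simp: s_def)
  obtain Q where Q: "G \<subseteq> Q" "disjoint Q" "\<Union>Q = {..<m}" "\<And>g. g \<in> Q \<Longrightarrow> card g = e"
    using extend_to_uniform_partition[of "{..<m}" e G] e m G by auto
  have "\<exists>R. disjoint R \<and> \<Union>R = {..<m} \<union> insert s (D w) \<and> (\<forall>L\<in>R. card L = e \<and> (\<exists>x\<in>L. x < m))"
    if w: "m \<le> w" "w < s" for w
  proof -
    have cD: "card (D w) = e - 1" unfolding D_def s_def
      using w by (intro card_rotational_outneighbours) (auto simp: s_def)
    have fD: "finite (D w)" by (auto simp: D_def)
    have Dm: "\<And>x. x \<in> D w \<Longrightarrow> m \<le> x \<and> x < s" by (auto simp: D_def)
    \<comment> \<open>The \<open>e\<close> new out-neighbours of \<open>w\<close> are placed in two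
      leaf sets, each with an old vertex: \<open>g\<close> joins the tournament neighbours to
      \<open>0\<close>, and \<open>h\<close> joins the sink to \<open>1, ..., e - 1\<close>. All
      remaining leaf sets are entirely old.\<close>
    define g where "g = insert 0 (D w)"
    define h where "h = insert s {1..<e}"
    have "0 \<notin> D w" "s \<notin> D w" using Dm m(2) by fastforce+
    then have cg: "card g = e" and cs: "card (insert s (D w)) = e" using cD fD e by (auto simp: g_def)
    have ch: "card h = e" using ms em e by (auto simp: h_def)
    have gh: "g \<inter> h = {}" using Dm em ms m(2) by (fastforce simp: g_def h_def)
    have "card ({..<m} \<union> insert s (D w)) = m + card (insert s (D w))"
      using fD Dm ms by (subst card_Un_disjoint) force+
    then have card: "card ({..<m} \<union> insert s (D w)) = m + e" using cs by simp
    obtain R where R: "{g, h} \<subseteq> R" "disjoint R" "\<Union>R = {..<m} \<union> insert s (D w)"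
      "\<And>L. L \<in> R \<Longrightarrow> card L = e"
    proof (rule extend_to_uniform_partition[of "{..<m} \<union> insert s (D w)" e "{g, h}"])
      show "e dvd card ({..<m} \<union> insert s (D w))" using card m by simp
      show "disjoint {g, h}" using gh by (auto simp: disjoint_def)
      show "L \<subseteq> {..<m} \<union> insert s (D w) \<and> card L = e" if "L \<in> {g, h}" for L
        using that cg ch em m(2) by (auto simp: g_def h_def)
    qed (use fD e in auto)
    have "\<exists>x\<in>L. x < m" if L: "L \<in> R" for L
    proof (cases "L = g \<or> L = h")
      case True
      moreover have "0 \<in> g" "1 \<in> h" using e by (auto simp: g_def h_def)
      moreover have "1 < m" using em e by simp
      ultimately show ?thesis using m(2) by blast
    next
      case False
      then have "L \<inter> g = {}" "L \<inter> h = {}" using L R(1,2) by (auto dest: disjointD)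
      then have "L \<inter> insert s (D w) = {}" by (auto simp: g_def h_def)
      moreover have "L \<noteq> {}" using R(4)[OF L] e by auto
      ultimately show ?thesis using R(3) L by blast
    qed
    then show ?thesis using R by blast
  qed
  then obtain R where R: "\<And>w. m \<le> w \<Longrightarrow> w < s \<Longrightarrow> disjoint (R w)"
    "\<And>w. m \<le> w \<Longrightarrow> w < s \<Longrightarrow> \<Union>(R w) = {..<m} \<union> insert s (D w)"
    "\<And>w L. m \<le> w \<Longrightarrow> w < s \<Longrightarrow> L \<in> R w \<Longrightarrow> card L = e \<and> (\<exists>x\<in>L. x < m)"
    by metis
  define P' where "P' v = (if v < m then P v else if v = s then Q else R v)" for v
  have old: "P' v = P v" if "v < m" for v using that by (simp add: P'_def)
  have sink: "P' s = Q" using ms by (simp add: P'_def)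
  have new: "P' v = R v" if "m \<le> v" "v < s" for v using that by (simp add: P'_def)
  have out_old: "\<Union>(P' v) \<subseteq> {..<m}" if "v < m" for v
    using P that unfolding oriented_stars_def old[OF that] by blast
  have out_new: "\<Union>(P' v) = {..<m} \<union> insert s (D v)" if "m \<le> v" "v < s" for v
    unfolding new[OF that] using R(2)[OF that] .
  have out_sink: "\<Union>(P' s) = {..<m}" unfolding sink using Q(3) .
  have Dsub: "D w \<subseteq> {m..<s}" for w by (auto simp: D_def)
  have tour: "(v \<in> \<Union>(P' u)) \<noteq> (u \<in> \<Union>(P' v))" if uv: "u < v" "v < Suc s" for u v
  proof -
    consider "v < m" | "u < m" "m \<le> v" "v < s" | "u < m" "v = s"
      | "m \<le> u" "v < s" | "m \<le> u" "v = s" using uv by linarith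
    then show ?thesis
    proof cases
      case 1
      then have "u < m" using uv by simp
      then show ?thesis using 1 uv P unfolding oriented_stars_def old[OF 1] old[OF \<open>u < m\<close>] by simp
    next
      case 2
      have "v \<notin> \<Union>(P' u)" using out_old[OF 2(1)] 2(2) by (meson lessThan_iff not_le subsetD)
      then show ?thesis unfolding out_new[OF 2(2,3)] using 2(1) by blast
    next
      case 3
      have "s \<notin> \<Union>(P' u)" using out_old[OF 3(1)] ms(1) by (meson lessThan_iff less_asym subsetD)
      then show ?thesis unfolding 3(2) out_sink using 3(1) by blast
    next
      case 4
      have u: "u < s" and v: "m \<le> v" using 4 uv by simp_all
      \<comment> \<open>For tournament vertices \<open>u < v\<close>, the edge leaves
        \<open>u\<close> if \<open>v < u + e\<close> and leaves \<open>v\<close> if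
        \<open>u + e \<le> v\<close>.\<close>
      show ?thesis unfolding out_new[OF 4(1) u] out_new[OF v 4(2)]
        using 4 uv by (auto simp: D_def)
    next
      case 5
      then have u: "u < s" using uv by simp
      show ?thesis unfolding 5(2) out_new[OF 5(1) u] out_sink using 5(1) by simp
    qed
  qed
  show ?thesis
  proof (rule that[of P' s])
    show "oriented_stars e {..<m + 2 * e} P'"
      unfolding oriented_stars_def ms(2)
    proof (intro conjI ballI impI)
      show "finite {..<Suc s}" by simp
    next
      fix v assume "v \<in> {..<Suc s}"
      then consider "v < m" | "m \<le> v" "v < s" | "v = s" by fastforce
      then have *: "disjoint (P' v) \<and> v \<notin> \<Union>(P' v) \<and>
        \<Union>(P' v) \<subseteq> {..<Suc s} \<and> (\<forall>L\<in>P' v. card L = e)"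
      proof cases
        case 1
        have "disjoint (P v)" "v \<notin> \<Union>(P v)" "\<forall>L\<in>P v. card L = e"
          using P 1 by (simp_all add: oriented_stars_def)
        moreover have "\<Union>(P' v) \<subseteq> {..<Suc s}" using out_old[OF 1] ms(1) by fastforce
        ultimately show ?thesis unfolding old[OF 1] by (intro conjI)
      next
        case 2
        have "v \<notin> D v" using e by (auto simp: D_def)
        then have "v \<notin> \<Union>(P' v)" unfolding out_new[OF 2] using 2 by simp
        moreover have "\<Union>(P' v) \<subseteq> {..<Suc s}" unfolding out_new[OF 2] using Dsub[of v] ms by auto
        moreover have "disjoint (P' v)" "\<forall>L\<in>P' v. card L = e"
          using R(1,3)[OF 2] by (simp_all add: new[OF 2])
        ultimately show ?thesis by (intro conjI)
      next
        case 3
        have "v \<notin> \<Union>(P' v)" "\<Union>(P' v) \<subseteq> {..<Suc s}" unfolding 3 out_sink using ms by auto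
        moreover have "disjoint (P' v)" "\<forall>L\<in>P' v. card L = e"
          using Q(2,4) by (simp_all add: 3 sink)
        ultimately show ?thesis by (intro conjI)
      qed
      show "disjoint (P' v)" "v \<notin> \<Union>(P' v)" using * by blast+
      show "L \<subseteq> {..<Suc s}" "card L = e" if "L \<in> P' v" for L using that * by blast+
    next
      fix u v assume "u \<in> {..<Suc s}" "v \<in> {..<Suc s}" "u \<noteq> v"
      then show "(v \<in> \<Union>(P' u)) \<noteq> (u \<in> \<Union>(P' v))"
        using tour[of u v] tour[of v u] by (cases u v rule: linorder_cases) auto
    qed
    show "\<exists>x\<in>L. x < m" if v: "m \<le> v" "v < m + 2 * e" and L: "L \<in> P' v" for v L
    proof (cases "v = s")
      case True
      then have "L \<subseteq> {..<m}" "L \<noteq> {}" using L Q(3) Q(4)[of L] e by (auto simp: sink)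
      then show ?thesis by (meson all_not_in_conv lessThan_iff subsetD)
    next
      case False
      then have "v < s" using v ms by simp
      then show ?thesis using R(3) L v by (simp add: new)
    qed
  qed (use old sink Q ms in auto)
qed

text \<open>The families in \<open>F\<close> are realised one at a time, each by a batch from
  \<open>extend_by_sink\<close> whose sink carries it. A batch keeps the system
  \<open>(q + 1)\<close>-colourable, and \<open>none\<close>, the negation of the intended result,
  turns this back into a \<open>q\<close>-colouring, so the process can continue.\<close>

lemma force_stars:
  assumes F: "finite F" and e: "e \<ge> 2" and P: "oriented_stars e {..<m} P"
    and m: "2 * e dvd m" "m > 0" and c: "\<exists>c. proper q {..<m} P c"
    and G: "\<And>G g. G \<in> F \<Longrightarrow> g \<in> G \<Longrightarrow> g \<subseteq> {..<m} \<and> card g = e" "\<And>G. G \<in> F \<Longrightarrow> disjoint G"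
    and none: "\<And>m P. oriented_stars e {..<m} P \<Longrightarrow> 2 * e dvd m \<Longrightarrow>
      \<exists>c. proper (Suc q) {..<m} P c \<Longrightarrow> \<exists>c. proper q {..<m} P c"
  shows "\<exists>m' P'. m \<le> m' \<and> oriented_stars e {..<m'} P' \<and> 2 * e dvd m' \<and>
    (\<exists>c. proper q {..<m'} P' c) \<and> (\<forall>v<m. P' v = P v) \<and> (\<forall>G\<in>F. \<exists>w<m'. G \<subseteq> P' w)"
  using F G
proof (induction F rule: finite_induct)
  case empty
  then show ?case using P m c by blast
next
  case (insert G F)
  then obtain m1 P1 c1 where 1: "m \<le> m1" "oriented_stars e {..<m1} P1" "2 * e dvd m1"
    "proper q {..<m1} P1 c1" "\<forall>v<m. P1 v = P v" "\<forall>G\<in>F. \<exists>w<m1. G \<subseteq> P1 w"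
    by (metis insertCI)
  have Gs: "g \<subseteq> {..<m1} \<and> card g = e" if "g \<in> G" for g
  proof -
    have "g \<subseteq> {..<m}" "card g = e" using insert.prems(1)[of G g] that by auto
    then show ?thesis using 1(1) by auto
  qed
  have "e dvd m1" using 1(3) dvd_mult_right by blast
  then obtain P2 w where 2: "oriented_stars e {..<m1 + 2 * e} P2" "\<And>v. v < m1 \<Longrightarrow> P2 v = P1 v"
    "w < m1 + 2 * e" "G \<subseteq> P2 w"
    "\<And>v L. m1 \<le> v \<Longrightarrow> v < m1 + 2 * e \<Longrightarrow> L \<in> P2 v \<Longrightarrow> \<exists>x\<in>L. x < m1"
    using extend_by_sink[OF 1(2) e _ _ insert.prems(2)[OF insertI1] Gs] 1(1) m(2) by auto
  \<comment> \<open>The whole batch gets the fresh colour \<open>q\<close>. Stars with an old centre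
    are unchanged, and every star with a new centre has an old leaf, coloured below
    \<open>q\<close>.\<close>
  have "proper (Suc q) {..<m1 + 2 * e} P2 (\<lambda>v. if v < m1 then c1 v else q)"
    unfolding proper_def
  proof (intro conjI ballI)
    show "(if v < m1 then c1 v else q) < Suc q" for v
      using 1(4) by (auto simp: proper_def intro: less_SucI)
  next
    fix v L assume v: "v \<in> {..<m1 + 2 * e}" and L: "L \<in> P2 v"
    show "\<exists>x\<in>L. (if x < m1 then c1 x else q) \<noteq> (if v < m1 then c1 v else q)"
    proof (cases "v < m1")
      case True
      then have L1: "L \<in> P1 v" using L 2(2) by simp
      then have "L \<subseteq> {..<m1}" using 1(2) True by (auto simp: oriented_stars_def)
      moreover obtain x where "x \<in> L" "c1 x \<noteq> c1 v"
        using 1(4) True L1 unfolding proper_def by blast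
      ultimately show ?thesis using True by auto
    next
      case False
      then obtain x where "x \<in> L" "x < m1" using 2(5)[of v L] v L by auto
      moreover then have "c1 x < q" using 1(4) by (simp add: proper_def)
      ultimately show ?thesis using False by (intro bexI[of _ x]) auto
    qed
  qed
  then have "\<exists>c. proper q {..<m1 + 2 * e} P2 c" using none[OF 2(1)] 1(3) by auto
  moreover have "\<exists>u<m1 + 2 * e. H \<subseteq> P2 u" if H: "H \<in> insert G F" for H
  proof (cases "H = G")
    case True
    then show ?thesis using 2(3,4) by blast
  next
    case False
    then obtain u where "u < m1" "H \<subseteq> P1 u" using 1(6) H by blast
    then show ?thesis using 2(2)[of u] by (intro exI[of _ u]) auto
  qed
  moreover have "\<forall>v<m. P2 v = P v" using 1(1,5) 2(2) by simp
  ultimately show ?case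
    using 1(1,3) 2(1) by (intro exI[of _ "m1 + 2 * e"] exI[of _ P2]) auto
qed

section \<open>Raising the chromatic number by one\<close>

lemma pigeonhole_fibre:
  assumes \<phi>: "\<phi> \<in> A \<rightarrow> B" and fin: "finite A" "finite B" and card: "card A > r * card B"
  obtains y where "card {x\<in>A. \<phi> x = y} > r"
proof (rule ccontr)
  assume "\<not> thesis"
  then have small: "card {x\<in>A. \<phi> x = y} \<le> r" for y using that by (meson not_le)
  have "A = (\<Union>y\<in>B. {x\<in>A. \<phi> x = y})" using \<phi> by auto
  then have "card A \<le> (\<Sum>y\<in>B. card {x\<in>A. \<phi> x = y})" using card_UN_le[OF fin(2)] by metis
  also have "\<dots> \<le> (\<Sum>y\<in>B. r)" by (intro sum_mono small)
  finally show False using card by (simp add: mult.commute)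
qed

lemma ex_chromatic_Suc:
  assumes e: "e \<ge> 2" and P: "oriented_stars e V P" and V: "2 * e dvd card V"
    and c: "proper q V P c" and min: "\<not> (\<exists>c. proper (q - 1) V P c)"
  shows "\<exists>m P. oriented_stars e {..<m::nat} P \<and> 2 * e dvd m \<and>
    (\<exists>c. proper (Suc q) {..<m} P c) \<and> \<not> (\<exists>c. proper q {..<m} P c)"
proof (rule ccontr)
  assume "\<not> ?thesis"
  then have none: "\<exists>c. proper q {..<m} P c"
    if "oriented_stars e {..<m} P" "2 * e dvd m" "\<exists>c. proper (Suc q) {..<m} P c"
    for m :: nat and P using that by blast
  have finV: "finite V" using P by (simp add: oriented_stars_def)
  \<comment> \<open>An empty system would be colourable even with \<open>q - 1\<close> colours.
    Nonemptiness yields \<open>q > 0\<close> and \<open>m > 0\<close>.\<close>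
  have "V \<noteq> {}"
  proof
    assume "V = {}"
    then have "proper (q - 1) V P c" by (simp add: proper_def)
    then show False using min by blast
  qed
  then have q: "q > 0" using c by (auto simp: proper_def)
  have "even (card V)" "e dvd card V" using V dvd_mult_left dvd_mult_right by blast+
  then obtain c' where c': "proper (Suc q) V P c'" "\<And>i. 2 * card {v\<in>V. c' v = i} \<le> card V"
    using balanced_colouring[OF P c] by blast
  obtain Q where Q: "disjoint Q" "\<Union>Q = V" "\<And>g. g \<in> Q \<Longrightarrow> card g = e"
    "\<And>g. g \<in> Q \<Longrightarrow> \<exists>x\<in>g. \<exists>y\<in>g. c' x \<noteq> c' y"
    using bichromatic_uniform_partition[OF finV e \<open>e dvd card V\<close> c'(2)] by metis
  \<comment> \<open>A copy has at most \<open>q ^ card V\<close> colourings, so \<open>N\<close>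
    exceeds \<open>e - 1\<close> times their number and some \<open>e\<close> copies must be
    coloured alike.\<close>
  define N where "N = e * q ^ card V"
  define X where "X = V \<times> {..<N}"
  define m where "m = card X"
  have finX: "finite X" using finV by (simp add: X_def)
  have "card X = card V * N" by (simp add: X_def card_cartesian_product)
  then have m: "2 * e dvd m" "m > 0"
    using V \<open>V \<noteq> {}\<close> finV q e by (auto simp: m_def N_def card_gt_0_iff)
  obtain f where f: "bij_betw f X {..<m}"
    using ex_bij_betw_finite_nat[OF finX] unfolding m_def atLeast0LessThan by blast
  then have inj: "inj_on f X" and im: "f ` X = {..<m}" by (auto simp: bij_betw_def)
  define P1 where "P1 y = (`) f ` copies N Q P (inv_into X f y)" for y
  have P1: "P1 (f v) = (`) f ` copies N Q P v" if "v \<in> X" for v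
    using that inj by (simp add: P1_def)
  have oX: "oriented_stars e X (copies N Q P)"
    unfolding X_def using oriented_stars_copies[OF P Q(1-3)] .
  have o1: "oriented_stars e {..<m} P1"
    using oriented_stars_image(1)[OF oX inj P1] im by simp
  have p1: "proper r {..<m} P1 d \<longleftrightarrow> proper r X (copies N Q P) (d \<circ> f)" for r d
    using oriented_stars_image(2)[OF oX inj P1] im by simp
  \<comment> \<open>The balanced colouring \<open>c'\<close>, repeated on every copy, shows that the
    union is \<open>(q + 1)\<close>-colourable.\<close>
  have "proper (Suc q) {..<m} P1 (c' \<circ> fst \<circ> inv_into X f)"
  proof -
    have "proper (Suc q) X (copies N Q P) (c' \<circ> fst)"
      unfolding X_def using proper_copies[OF c'(1) Q(4)] .
    moreover have "(c' \<circ> fst \<circ> inv_into X f \<circ> f) v = (c' \<circ> fst) v" if "v \<in> X" for v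
      using that inj by simp
    ultimately have "proper (Suc q) X (copies N Q P) (c' \<circ> fst \<circ> inv_into X f \<circ> f)"
      using proper_cong[OF oX] by blast
    then show ?thesis using p1 by blast
  qed
  then have c1: "\<exists>c. proper q {..<m} P1 c" using none[OF o1 m(1)] by blast
  \<comment> \<open>If the copies in \<open>J\<close> are coloured alike, each set of
    \<open>grp J\<close> is monochromatic, so a centre carrying all of them must avoid every colour
    of the copy. Which \<open>J\<close> occurs depends on the final colouring, so \<open>F\<close>
    provides for all of them beforehand.\<close>
  define grp where "grp J = (\<lambda>v. f ` ({v} \<times> J)) ` V" for J
  define F where "F = grp ` {J. J \<subseteq> {..<N} \<and> card J = e}"
  have "finite F" by (simp add: F_def)
  moreover have "g \<subseteq> {..<m} \<and> card g = e" if GF: "G \<in> F" and gG: "g \<in> G" for G g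
  proof -
    obtain J v where J: "J \<subseteq> {..<N}" "card J = e" "v \<in> V" "g = f ` ({v} \<times> J)"
      using GF gG by (auto simp: F_def grp_def)
    then have sub: "{v} \<times> J \<subseteq> X" by (auto simp: X_def)
    then have "card g = card ({v} \<times> J)"
      unfolding J(4) by (intro card_image inj_on_subset[OF inj])
    then show ?thesis using sub im J(2,4) by (auto simp: card_cartesian_product)
  qed
  moreover have "disjoint G" if GF: "G \<in> F" for G
  proof -
    obtain J where J: "J \<subseteq> {..<N}" "G = grp J" using GF by (auto simp: F_def)
    have "f ` ({v} \<times> J) \<inter> f ` ({u} \<times> J) = {}" if "v \<in> V" "u \<in> V" "v \<noteq> u" for u v
    proof -
      have "{v} \<times> J \<subseteq> X" "{u} \<times> J \<subseteq> X" using that J by (auto simp: X_def)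
      then have "f ` ({v} \<times> J) \<inter> f ` ({u} \<times> J) = f ` (({v} \<times> J) \<inter> ({u} \<times> J))"
        using inj_on_image_Int[OF inj] by metis
      also have "({v} \<times> J) \<inter> ({u} \<times> J) = {}" using that by auto
      finally show ?thesis by simp
    qed
    then show ?thesis unfolding J(2) grp_def disjoint_def by auto
  qed
  ultimately obtain m2 P2 d where 2: "m \<le> m2" "proper q {..<m2} P2 d"
    "\<forall>v<m. P2 v = P1 v" "\<forall>G\<in>F. \<exists>w<m2. G \<subseteq> P2 w"
    using force_stars[of F e m P1 q, OF _ e o1 m c1 _ _ none] by blast
  have "proper q {..<m} P1 d" using 2(1-3) by (auto simp: proper_def)
  then have dX: "proper q (V \<times> {..<N}) (copies N Q P) (d \<circ> f)" using p1 by (simp add: X_def)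
  \<comment> \<open>Restricting to \<open>V\<close> places the colouring of copy \<open>j\<close> in
    a finite function space, as the pigeonhole argument requires.\<close>
  define \<phi> where "\<phi> j = restrict (\<lambda>x. d (f (x, j))) V" for j
  have "\<phi> \<in> {..<N} \<rightarrow> (V \<rightarrow>\<^sub>E {..<q})"
    using dX by (auto simp: \<phi>_def proper_def)
  moreover have "card {..<N} > (e - 1) * card (V \<rightarrow>\<^sub>E {..<q})"
    using finV q e by (simp add: card_funcsetE N_def)
  moreover have "finite (V \<rightarrow>\<^sub>E {..<q})" using finV by (intro finite_PiE) auto
  ultimately obtain y where y: "card {j\<in>{..<N}. \<phi> j = y} > e - 1"
    using pigeonhole_fibre[of \<phi> "{..<N}" "V \<rightarrow>\<^sub>E {..<q}" "e - 1"] by auto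
  then have "e \<le> card {j\<in>{..<N}. \<phi> j = y}" by simp
  then obtain J where J: "J \<subseteq> {j\<in>{..<N}. \<phi> j = y}" "card J = e"
    by (meson obtain_subset_with_card_n)
  then have "grp J \<in> F" by (auto simp: F_def)
  then obtain w where w: "w < m2" "grp J \<subseteq> P2 w" using 2(4) by blast
  have "J \<noteq> {}" using J(2) e by auto
  then obtain j where j: "j \<in> J" by blast
  then have jN: "j < N" using J(1) by auto
  have "d w < q" using w 2(2) by (simp add: proper_def)
  then obtain v where v: "v \<in> V" "d (f (v, j)) = d w"
    using proper_uses_all_colours[OF P proper_copy[OF dX jN] min] by auto
  have "f ` ({v} \<times> J) \<in> P2 w" using w v(1) by (auto simp: grp_def)
  then obtain x where "x \<in> f ` ({v} \<times> J)" "d x \<noteq> d w"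
    using 2(2) w(1) unfolding proper_def by blast
  then obtain i where i: "i \<in> J" "d (f (v, i)) \<noteq> d w" by auto
  have "\<phi> i = y" "\<phi> j = y" using i(1) j J(1) by auto
  then have "\<phi> i v = \<phi> j v" by simp
  then show False using i(2) v by (simp add: \<phi>_def)
qed

section \<open>Translation back to star systems\<close>

theorem theorem3p3:
  fixes k e :: nat
  assumes "k \<ge> 3" and "e \<ge> 3"
    and "\<exists>n (V :: 'a set) \<B>. star_system e n V \<B> \<and> chromatic (k - 1) V \<B> \<and> [n = 0] (mod (2 * e))"
  shows "\<exists>n (V :: nat set) \<B>. star_system e n V \<B> \<and> chromatic k V \<B> \<and> [n = 0] (mod (2 * e))"
proof -
  have e: "e \<ge> 2" and k: "Suc (k - 1) = k" using assms(1,2) by simp_all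
  obtain n and V :: "'a set" and \<B> where B: "star_system e n V \<B>" "chromatic (k - 1) V \<B>"
    "2 * e dvd n" using assms(3) by (auto simp: cong_0_iff)
  obtain P where P: "oriented_stars e V P" "\<B> = stars_of V P"
    using oriented_stars_if_star_system[OF B(1) e] .
  have V: "2 * e dvd card V" using B(1,3) by (simp add: star_system_def)
  obtain c where c: "proper (k - 1) V P c"
    using B(2) colourable_stars_of_iff[OF P(1)] by (auto simp: chromatic_def P(2))
  have "\<not> (\<exists>c. proper (k - 1 - 1) V P c)"
    using B(2) colourable_stars_of_iff[OF P(1)] by (auto simp: chromatic_def P(2))
  from ex_chromatic_Suc[OF e P(1) V c this] obtain m :: nat and P' where
    P': "oriented_stars e {..<m} P'" "2 * e dvd m"
    "\<exists>c. proper k {..<m} P' c" "\<not> (\<exists>c. proper (k - 1) {..<m} P' c)"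
    unfolding k by auto
  have "star_system e m {..<m} (stars_of {..<m} P')"
    using star_system_stars_of[OF P'(1) e] by simp
  moreover have "chromatic k {..<m} (stars_of {..<m} P')"
    using P'(3,4) unfolding chromatic_def colourable_stars_of_iff[OF P'(1)] by simp
  ultimately show ?thesis using P'(2) by (auto simp: cong_0_iff)
qed

end
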